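(* Let $\Gamma$ be a finite abelian group with a symmetric generating set $S$, and let $\mathbf r$ and $\mathbf r'$ be two sets of positive rates on $S$ with $r_s=r_{s^{-1}}$, $r'_s=r'_{s^{-1}}$ and $r_s\le r'_s$ for all $s\in S$. Let $t>0$. Then the distribution at time $t$ of the random walk with rates $\mathbf r$ started at the identity majorizes the distribution at time $t$ of the random walk with rates $\mathbf r'$ started at the identity.
   Context: The random walk with rates $\mathbf r=(r_s)_{s\in S}$ is the continuous-time Markov chain on $\Gamma$ that jumps from $x$ to $xs$ at rate $r_s$ for each $s\in S$. Symmetric means $s\in S\Rightarrow s^{-1}\in S$. For vectors $f,g$ of length $n$ with decreasing rearrangements $f_{[1]}\ge\dots\ge f_{[n]}$ and $g_{[1]}\ge\dots\ge g_{[n]}$, $f$ majorizes $g$ if $f_{[1]}+\dots+f_{[i]}\ge g_{[1]}+\dots+g_{[i]}$ for each $i$, with equality when $i=n$. *)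

theory Defs
  imports "HOL-Probability.Probability" "HOL-Algebra.Generated_Groups"
begin

text \<open>Transition function of a time-homogeneous Markov chain in continuous time on a finite
  state space \<open>A\<close>: \<open>p t x y\<close> is the probability of going from \<open>x\<close> to \<open>y\<close> in time \<open>t\<close>. Only
  \<open>t \<ge> 0\<close> and \<open>x, y \<in> A\<close> matter.\<close>

definition transition_function :: "'a set \<Rightarrow> (real \<Rightarrow> 'a \<Rightarrow> 'a \<Rightarrow> real) \<Rightarrow> bool" where
  "transition_function A p \<longleftrightarrow>
     (\<forall>t\<ge>0. \<forall>x\<in>A. \<forall>y\<in>A. 0 \<le> p t x y) \<and>
     (\<forall>t\<ge>0. \<forall>x\<in>A. (\<Sum>y\<in>A. p t x y) = 1) \<and>
     (\<forall>x\<in>A. \<forall>y\<in>A. p 0 x y = (if x = y then 1 else 0)) \<and>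
     (\<forall>s\<ge>0. \<forall>t\<ge>0. \<forall>x\<in>A. \<forall>y\<in>A. p (s + t) x y = (\<Sum>z\<in>A. p s x z * p t z y))"

text \<open>\<open>q x y\<close> is the rate of jumping from \<open>x\<close> to \<open>y\<close>. Only \<open>x \<noteq> y\<close> matters; the derivative
  on the diagonal is determined by the rows of \<open>p t\<close> summing to 1.\<close>

definition has_jump_rates ::
    "'a set \<Rightarrow> (real \<Rightarrow> 'a \<Rightarrow> 'a \<Rightarrow> real) \<Rightarrow> ('a \<Rightarrow> 'a \<Rightarrow> real) \<Rightarrow> bool" where
  "has_jump_rates A p q \<longleftrightarrow>
     (\<forall>x\<in>A. \<forall>y\<in>A. x \<noteq> y \<longrightarrow> ((\<lambda>h. p h x y / h) \<longlongrightarrow> q x y) (at_right 0))"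

text \<open>The process \<open>X\<close> is indexed by times \<open>t \<ge> 0\<close>. The Markov property is written without
  conditional probabilities, so that conditioning on null events needs no convention. No path
  regularity is required: the marginal laws do not depend on it.\<close>

definition continuous_time_markov_chain ::
    "'w measure \<Rightarrow> 'a set \<Rightarrow> ('a \<Rightarrow> 'a \<Rightarrow> real) \<Rightarrow> (real \<Rightarrow> 'w \<Rightarrow> 'a) \<Rightarrow> bool" where
  "continuous_time_markov_chain M A q X \<longleftrightarrow>
     prob_space M \<and>
     (\<forall>t\<ge>0. X t \<in> measurable M (count_space A)) \<and>
     (\<exists>p. transition_function A p \<and> has_jump_rates A p q \<and>
        (\<forall>n (\<tau> :: nat \<Rightarrow> real) (x :: nat \<Rightarrow> 'a).
           0 \<le> \<tau> 0 \<longrightarrow> (\<forall>i\<le>n. \<tau> i < \<tau> (Suc i)) \<longrightarrow> (\<forall>i\<le>Suc n. x i \<in> A) \<longrightarrow>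
           \<P>(\<omega> in M. \<forall>i\<le>Suc n. X (\<tau> i) \<omega> = x i) =
           \<P>(\<omega> in M. \<forall>i\<le>n. X (\<tau> i) \<omega> = x i) * p (\<tau> (Suc n) - \<tau> n) (x n) (x (Suc n))))"

definition walk_rate ::
    "('a, 'b) monoid_scheme \<Rightarrow> 'a set \<Rightarrow> ('a \<Rightarrow> real) \<Rightarrow> 'a \<Rightarrow> 'a \<Rightarrow> real" where
  "walk_rate G S r x y = (\<Sum>s\<in>{s \<in> S. x \<otimes>\<^bsub>G\<^esub> s = y}. r s)"

definition random_walk_from_one ::
    "'w measure \<Rightarrow> ('a, 'b) monoid_scheme \<Rightarrow> 'a set \<Rightarrow> ('a \<Rightarrow> real) \<Rightarrow> (real \<Rightarrow> 'w \<Rightarrow> 'a) \<Rightarrow> bool" where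
  "random_walk_from_one M G S r X \<longleftrightarrow>
     continuous_time_markov_chain M (carrier G) (walk_rate G S r) X \<and>
     \<P>(\<omega> in M. X 0 \<omega> = \<one>\<^bsub>G\<^esub>) = 1"

definition law_at :: "'w measure \<Rightarrow> (real \<Rightarrow> 'w \<Rightarrow> 'a) \<Rightarrow> real \<Rightarrow> 'a \<Rightarrow> real" where
  "law_at M X t x = \<P>(\<omega> in M. X t \<omega> = x)"

definition decreasing_rearrangement :: "'a set \<Rightarrow> ('a \<Rightarrow> real) \<Rightarrow> real list" where
  "decreasing_rearrangement A f = rev (sorted_list_of_multiset (image_mset f (mset_set A)))"

text \<open>Vectors are indexed by a finite set \<open>A\<close>; the list positions start at 0.\<close>

definition majorizes_on :: "'a set \<Rightarrow> ('a \<Rightarrow> real) \<Rightarrow> ('a \<Rightarrow> real) \<Rightarrow> bool" where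
  "majorizes_on A f g \<longleftrightarrow>
     (\<forall>i\<in>{1..card A}.
        (\<Sum>j<i. decreasing_rearrangement A f ! j) \<ge> (\<Sum>j<i. decreasing_rearrangement A g ! j)) \<and>
     (\<Sum>j<card A. decreasing_rearrangement A f ! j) =
     (\<Sum>j<card A. decreasing_rearrangement A g ! j)"

end

(*
  The two generators commute because the group is abelian, so the law with rates r' is the
  law with rates r convolved with a probability measure, namely the law with rates r' - r.
  A convolution averages translates, hence does not increase sum_x phi (f x) for convex phi;
  for phi v = max 0 (v - c), with c ranging over all reals, this is majorization.

  Instead of building the third semigroup, time t is cut into n steps and the convolution is
  replaced by n Euler steps with rates r' - r; the L1 error tends to 0 as n grows.
*)
theory Submission
  imports Defs "HOL-Real_Asymp.Real_Asymp"
begin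

section \<open>Majorization through truncated sums\<close>

lemma length_decreasing_rearrangement:
  "length (decreasing_rearrangement A f) = card A"
  unfolding decreasing_rearrangement_def
  by (metis length_rev mset_sorted_list_of_multiset size_image_mset size_mset size_mset_set)

lemma decreasing_rearrangement_antimono:
  assumes "i \<le> j" "j < card A"
  shows "decreasing_rearrangement A f ! j \<le> decreasing_rearrangement A f ! i"
proof -
  have "sorted (rev (decreasing_rearrangement A f))"
    by (simp add: decreasing_rearrangement_def)
  then show ?thesis
    using assms by (simp add: sorted_rev_nth_mono length_decreasing_rearrangement)
qed

text \<open>Sorting only permutes the multiset of values, so any sum over list positions can be
  traded for a sum over \<open>A\<close>.\<close>

lemma sum_decreasing_rearrangement:
  fixes h :: "real \<Rightarrow> real"
  shows "(\<Sum>j<card A. h (decreasing_rearrangement A f ! j)) = (\<Sum>x\<in>A. h (f x))"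
proof -
  have "(\<Sum>j<card A. h (decreasing_rearrangement A f ! j))
      = sum_list (map h (decreasing_rearrangement A f))"
    by (simp add: sum_list_sum_nth length_decreasing_rearrangement atLeast0LessThan)
  also have "\<dots> = sum_mset (image_mset h (mset (decreasing_rearrangement A f)))"
    by (metis mset_map sum_mset_sum_list)
  also have "\<dots> = (\<Sum>x\<in>A. h (f x))"
    by (simp add: decreasing_rearrangement_def sum_unfold_sum_mset image_mset.compositionality comp_def)
  finally show ?thesis .
qed

text \<open>For every threshold \<open>c\<close>, the \<open>i\<close> largest values of
  \<open>g\<close> add up to at most \<open>i * c\<close> plus the truncated sum of
  \<open>g\<close>. For \<open>f\<close> this is an equality if \<open>c\<close> is its
  \<open>i\<close>-th largest value, so comparing truncated sums at that \<open>c\<close> compares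
  the partial sums.\<close>

lemma majorizes_onI_truncated_sums:
  fixes f g :: "'a \<Rightarrow> real"
  assumes trunc: "\<And>c. (\<Sum>x\<in>A. max 0 (g x - c)) \<le> (\<Sum>x\<in>A. max 0 (f x - c))"
    and total: "(\<Sum>x\<in>A. f x) = (\<Sum>x\<in>A. g x)"
  shows "majorizes_on A f g"
proof -
  let ?F = "\<lambda>j. decreasing_rearrangement A f ! j"
  let ?G = "\<lambda>j. decreasing_rearrangement A g ! j"
  have "(\<Sum>j<i. ?G j) \<le> (\<Sum>j<i. ?F j)" if i: "i \<in> {1..card A}" for i
  proof -
    \<comment> \<open>Positions start at 0, so this is the \<open>i\<close>-th largest value of
      \<open>f\<close>. Truncation at \<open>c\<close> then leaves the first \<open>i\<close>
      differences unchanged and makes all later ones 0.\<close>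
    define c where "c = ?F (i - 1)"
    have above: "max 0 (?F j - c) = ?F j - c" if "j < i" for j
      using decreasing_rearrangement_antimono[of j "i - 1" A f] that i by (auto simp: c_def)
    have below: "max 0 (?F j - c) = 0" if "i \<le> j" "j < card A" for j
      using decreasing_rearrangement_antimono[of "i - 1" j A f] that i by (auto simp: c_def)
    have "(\<Sum>j<i. ?G j) - real i * c = (\<Sum>j<i. ?G j - c)"
      by (simp add: sum_subtractf)
    also have "\<dots> \<le> (\<Sum>j<i. max 0 (?G j - c))"
      by (intro sum_mono) simp
    also have "\<dots> \<le> (\<Sum>j<card A. max 0 (?G j - c))"
      using i by (intro sum_mono2) auto
    also have "\<dots> \<le> (\<Sum>j<card A. max 0 (?F j - c))"
      using trunc[of c] by (simp add: sum_decreasing_rearrangement[where h = "\<lambda>v. max 0 (v - c)"])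
    also have "\<dots> = (\<Sum>j<i. max 0 (?F j - c))"
      using i below by (intro sum.mono_neutral_right) auto
    also have "\<dots> = (\<Sum>j<i. ?F j - c)"
      using above by (intro sum.cong) auto
    also have "\<dots> = (\<Sum>j<i. ?F j) - real i * c"
      by (simp add: sum_subtractf)
    finally show ?thesis by simp
  qed
  moreover have "(\<Sum>j<card A. ?F j) = (\<Sum>j<card A. ?G j)"
    using total by (simp add: sum_decreasing_rearrangement[where h = "\<lambda>v. v"])
  ultimately show ?thesis
    by (simp add: majorizes_on_def)
qed

section \<open>Euler steps of the forward equation\<close>

definition l1_dist :: "'a set \<Rightarrow> ('a \<Rightarrow> real) \<Rightarrow> ('a \<Rightarrow> real) \<Rightarrow> real" where
  "l1_dist A f g = (\<Sum>x\<in>A. \<bar>f x - g x\<bar>)"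

lemma l1_dist_triangle: "l1_dist A f h \<le> l1_dist A f g + l1_dist A g h"
  unfolding l1_dist_def sum.distrib[symmetric] by (intro sum_mono) linarith

lemma l1_dist_commute: "l1_dist A f g = l1_dist A g f"
  by (simp add: l1_dist_def abs_minus_commute)

locale finite_abelian_walk = comm_group G for G (structure) +
  fixes S :: "'a set"
  assumes finite_carrier: "finite (carrier G)" and S_subset: "S \<subseteq> carrier G"
begin

lemma finite_S: "finite S"
  using finite_carrier S_subset finite_subset by blast

text \<open>Setting the generator to \<open>0\<close> outside the carrier makes two generators commute as
  operators on all functions, not just up to equality on the carrier.\<close>

definition gen :: "('a \<Rightarrow> real) \<Rightarrow> ('a \<Rightarrow> real) \<Rightarrow> 'a \<Rightarrow> real" where
  "gen r f x = (if x \<in> carrier G then \<Sum>s\<in>S. r s * (f (x \<otimes> inv s) - f x) else 0)"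

text \<open>One explicit Euler step of length \<open>h\<close> for the forward equation
  \<open>f' = gen r f\<close>, in which mass reaches \<open>x\<close> through the jump
  \<open>s\<close> from \<open>x \<otimes> inv s\<close>.\<close>

definition euler :: "('a \<Rightarrow> real) \<Rightarrow> real \<Rightarrow> ('a \<Rightarrow> real) \<Rightarrow> 'a \<Rightarrow> real" where
  "euler r h f x = f x + h * gen r f x"

section \<open>Mass conservation, linearity and commutation of generators\<close>

lemma sum_translate:
  assumes "s \<in> carrier G"
  shows "(\<Sum>x\<in>carrier G. f (x \<otimes> inv s)) = (\<Sum>x\<in>carrier G. f x)"
  by (rule sum.reindex_bij_witness[where i = "\<lambda>x. x \<otimes> s" and j = "\<lambda>x. x \<otimes> inv s"])
    (use assms in \<open>auto simp: m_assoc\<close>)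

text \<open>Translation permutes the group, so for each jump the total gain equals the total
  loss.\<close>

lemma sum_gen: "(\<Sum>x\<in>carrier G. gen r f x) = 0"
proof -
  have "(\<Sum>x\<in>carrier G. gen r f x)
      = (\<Sum>s\<in>S. r s * ((\<Sum>x\<in>carrier G. f (x \<otimes> inv s)) - (\<Sum>x\<in>carrier G. f x)))"
    by (simp add: gen_def sum_distrib_left sum_subtractf[symmetric] sum.swap[of _ "carrier G"])
  then show ?thesis
    using S_subset by (auto simp: sum_translate subset_iff intro!: sum.neutral)
qed

lemma sum_euler: "(\<Sum>x\<in>carrier G. euler r h f x) = (\<Sum>x\<in>carrier G. f x)"
  by (simp add: euler_def sum.distrib sum_distrib_left[symmetric] sum_gen)

lemma gen_diff: "gen r (\<lambda>x. f x - g x) = (\<lambda>x. gen r f x - gen r g x)"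
  by (simp add: gen_def fun_eq_iff sum_subtractf right_diff_distrib)

lemma euler_diff: "euler r h (\<lambda>x. f x - g x) = (\<lambda>x. euler r h f x - euler r h g x)"
  by (simp add: euler_def gen_diff fun_eq_iff algebra_simps)

text \<open>The form \<open>f + c * g\<close> is that of an Euler step, so this rewrites a generator
  applied to an Euler step.\<close>

lemma gen_linear: "gen r (\<lambda>x. f x + c * g x) = (\<lambda>x. gen r f x + c * gen r g x)"
  by (simp add: gen_def fun_eq_iff sum_distrib_left sum.distrib sum_subtractf algebra_simps)

lemma gen_add_rates: "gen (\<lambda>s. r s + d s) f x = gen r f x + gen d f x"
  by (simp add: gen_def distrib_right sum.distrib)

text \<open>Each generator is a combination of translations, and translations of an abelian group
  commute.\<close>

lemma gen_commute: "gen r (gen d f) = gen d (gen r f)"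
proof
  fix x
  show "gen r (gen d f) x = gen d (gen r f) x"
  proof (cases "x \<in> carrier G")
    case True
    have comm: "x \<otimes> inv a \<otimes> inv b = x \<otimes> inv b \<otimes> inv a" if "a \<in> S" "b \<in> S" for a b
      using that True S_subset by (metis inv_closed m_assoc m_comm subsetD)
    \<comment> \<open>The composition is a weighted sum of mixed second differences. By
      \<open>comm\<close> these are symmetric in the two jumps, so exchanging the sums exchanges the
      generators.\<close>
    have expand: "gen p (gen q f) x = (\<Sum>a\<in>S. \<Sum>b\<in>S. p a * q b *
        (f (x \<otimes> inv a \<otimes> inv b) - f (x \<otimes> inv a) - f (x \<otimes> inv b) + f x))" for p q
    proof -
      have "gen p (gen q f) x = (\<Sum>a\<in>S. p a *
          ((\<Sum>b\<in>S. q b * (f (x \<otimes> inv a \<otimes> inv b) - f (x \<otimes> inv a)))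
            - (\<Sum>b\<in>S. q b * (f (x \<otimes> inv b) - f x))))"
        using True S_subset by (auto simp: gen_def subset_iff intro!: sum.cong)
      then show ?thesis
        by (simp add: sum_subtractf[symmetric] sum_distrib_left algebra_simps)
    qed
    have "gen r (gen d f) x = (\<Sum>b\<in>S. \<Sum>a\<in>S. r a * d b *
        (f (x \<otimes> inv a \<otimes> inv b) - f (x \<otimes> inv a) - f (x \<otimes> inv b) + f x))"
      unfolding expand by (rule sum.swap)
    also have "\<dots> = gen d (gen r f) x"
      unfolding expand by (intro sum.cong refl) (simp add: comm algebra_simps)
    finally show ?thesis .
  qed (simp add: gen_def)
qed

lemma euler_commute: "euler r h (euler d h f) = euler d h (euler r h f)"
proof -
  have "euler p h (euler q h f) = (\<lambda>x. f x + h * gen q f x + h * gen p f x + h * (h * gen p (gen q f) x))"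
    for p q
    unfolding euler_def gen_linear by (simp add: algebra_simps)
  then show ?thesis
    by (simp add: gen_commute[of r d] algebra_simps)
qed

lemma funpow_euler_commute:
  "euler r h ((euler d h ^^ k) f) = (euler d h ^^ k) (euler r h f)"
  by (induction k) (simp_all add: euler_commute[of r h d])

section \<open>Jensen's inequality and L1 bounds for Euler steps\<close>

text \<open>If \<open>h * sum r S \<le> 1\<close>, an Euler step is a convex combination of
  \<open>f\<close> and its translates. Jensen's inequality applies at each point, and after
  summation over the group every translate contributes the same amount as \<open>f\<close>.\<close>

lemma convex_sum_euler:
  assumes phi: "convex_on UNIV (\<phi> :: real \<Rightarrow> real)"
    and r: "\<And>s. s \<in> S \<Longrightarrow> 0 \<le> r s" and h: "0 \<le> h" "h * sum r S \<le> 1"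
  shows "(\<Sum>x\<in>carrier G. \<phi> (euler r h f x)) \<le> (\<Sum>x\<in>carrier G. \<phi> (f x))"
proof -
  \<comment> \<open>\<open>None\<close> carries the weight of staying put, nonnegative by the bound
    on \<open>h\<close>; \<open>Some s\<close> carries the weight of the jump
    \<open>s\<close>.\<close>
  define w where "w = case_option (1 - h * sum r S) (\<lambda>s. h * r s)"
  have split: "(\<Sum>i\<in>insert None (Some ` S). F i) = F None + (\<Sum>s\<in>S. F (Some s))"
    for F :: "'a option \<Rightarrow> real"
    using finite_S by (subst sum.insert) (auto simp: sum.reindex)
  have pointwise: "\<phi> (euler r h f x)
      \<le> (1 - h * sum r S) * \<phi> (f x) + (\<Sum>s\<in>S. h * r s * \<phi> (f (x \<otimes> inv s)))"
    if "x \<in> carrier G" for x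
  proof -
    define v where "v = case_option (f x) (\<lambda>s. f (x \<otimes> inv s))"
    have "euler r h f x = (\<Sum>i\<in>insert None (Some ` S). w i *\<^sub>R v i)"
      unfolding split using that
      by (simp add: w_def v_def euler_def gen_def algebra_simps sum_subtractf sum_distrib_left)
    also have "\<phi> \<dots> \<le> (\<Sum>i\<in>insert None (Some ` S). w i * \<phi> (v i))"
    proof (rule convex_on_sum[OF _ _ phi])
      show "sum w (insert None (Some ` S)) = 1"
        unfolding split by (simp add: w_def sum_distrib_left)
      show "0 \<le> w i" if "i \<in> insert None (Some ` S)" for i
        using that r h by (auto simp: w_def)
    qed (use finite_S in auto)
    finally show ?thesis
      unfolding split by (simp add: w_def v_def)
  qed
  have "(\<Sum>x\<in>carrier G. \<phi> (euler r h f x)) \<le> (\<Sum>x\<in>carrier G.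
      (1 - h * sum r S) * \<phi> (f x) + (\<Sum>s\<in>S. h * r s * \<phi> (f (x \<otimes> inv s))))"
    using pointwise by (rule sum_mono)
  also have "\<dots> = (1 - h * sum r S) * (\<Sum>x\<in>carrier G. \<phi> (f x))
      + (\<Sum>s\<in>S. h * r s * (\<Sum>x\<in>carrier G. \<phi> (f (x \<otimes> inv s))))"
    by (simp add: sum.distrib sum_distrib_left sum.swap[of _ "carrier G" S])
  also have "(\<Sum>s\<in>S. h * r s * (\<Sum>x\<in>carrier G. \<phi> (f (x \<otimes> inv s))))
      = (\<Sum>s\<in>S. h * r s * (\<Sum>x\<in>carrier G. \<phi> (f x)))"
    using S_subset by (intro sum.cong refl) (metis (no_types) sum_translate[of _ "\<lambda>x. \<phi> (f x)"] subsetD)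
  finally show ?thesis
    by (simp add: algebra_simps sum_distrib_left sum_distrib_right)
qed

lemma convex_sum_funpow_euler:
  assumes "convex_on UNIV (\<phi> :: real \<Rightarrow> real)"
    and "\<And>s. s \<in> S \<Longrightarrow> 0 \<le> r s" and "0 \<le> h" "h * sum r S \<le> 1"
  shows "(\<Sum>x\<in>carrier G. \<phi> ((euler r h ^^ k) f x)) \<le> (\<Sum>x\<in>carrier G. \<phi> (f x))"
proof (induction k)
  case (Suc k)
  then show ?case
    using convex_sum_euler[OF assms, of "(euler r h ^^ k) f"] by simp
qed simp

text \<open>The step is linear, so contraction in L1 is the convex inequality for the absolute
  value, applied to \<open>f - g\<close>.\<close>

lemma l1_dist_euler:
  assumes "\<And>s. s \<in> S \<Longrightarrow> 0 \<le> r s" and "0 \<le> h" "h * sum r S \<le> 1"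
  shows "l1_dist (carrier G) (euler r h f) (euler r h g) \<le> l1_dist (carrier G) f g"
proof -
  have "convex_on UNIV (\<lambda>v::real. \<bar>v\<bar>)"
    using convex_on_dist[of UNIV "0::real"] by simp
  from convex_sum_euler[OF this assms, of "\<lambda>x. f x - g x"] show ?thesis
    by (simp add: l1_dist_def euler_diff)
qed

lemma l1_dist_funpow_euler:
  assumes "\<And>s. s \<in> S \<Longrightarrow> 0 \<le> r s" and "0 \<le> h" "h * sum r S \<le> 1"
  shows "l1_dist (carrier G) ((euler r h ^^ k) f) ((euler r h ^^ k) g) \<le> l1_dist (carrier G) f g"
proof (induction k)
  case (Suc k)
  then show ?case
    using l1_dist_euler[OF assms, of "(euler r h ^^ k) f" "(euler r h ^^ k) g"] by simp
qed simp

text \<open>Each difference in the generator is bounded by two terms with the same L1 norm, so the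
  operator norm on L1 is at most \<open>2 * sum r S\<close>.\<close>

lemma sum_abs_gen:
  assumes "\<And>s. s \<in> S \<Longrightarrow> 0 \<le> r s"
  shows "(\<Sum>x\<in>carrier G. \<bar>gen r f x\<bar>) \<le> 2 * sum r S * (\<Sum>x\<in>carrier G. \<bar>f x\<bar>)"
proof -
  have "(\<Sum>x\<in>carrier G. \<bar>gen r f x\<bar>)
      \<le> (\<Sum>x\<in>carrier G. \<Sum>s\<in>S. r s * (\<bar>f (x \<otimes> inv s)\<bar> + \<bar>f x\<bar>))"
  proof (rule sum_mono)
    fix x assume "x \<in> carrier G"
    then have "\<bar>gen r f x\<bar> \<le> (\<Sum>s\<in>S. \<bar>r s * (f (x \<otimes> inv s) - f x)\<bar>)"
      by (simp add: gen_def sum_abs)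
    also have "\<dots> \<le> (\<Sum>s\<in>S. r s * (\<bar>f (x \<otimes> inv s)\<bar> + \<bar>f x\<bar>))"
      using assms by (intro sum_mono) (auto simp: abs_mult intro!: mult_left_mono)
    finally show "\<bar>gen r f x\<bar> \<le> (\<Sum>s\<in>S. r s * (\<bar>f (x \<otimes> inv s)\<bar> + \<bar>f x\<bar>))" .
  qed
  also have "\<dots> = (\<Sum>s\<in>S. r s *
      ((\<Sum>x\<in>carrier G. \<bar>f (x \<otimes> inv s)\<bar>) + (\<Sum>x\<in>carrier G. \<bar>f x\<bar>)))"
    by (simp add: sum.distrib[symmetric] sum_distrib_left sum.swap[of _ "carrier G" S])
  also have "\<dots> = (\<Sum>s\<in>S. r s * (2 * (\<Sum>x\<in>carrier G. \<bar>f x\<bar>)))"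
  proof (intro sum.cong refl)
    fix s assume "s \<in> S"
    then show "r s * ((\<Sum>x\<in>carrier G. \<bar>f (x \<otimes> inv s)\<bar>) + (\<Sum>x\<in>carrier G. \<bar>f x\<bar>))
        = r s * (2 * (\<Sum>x\<in>carrier G. \<bar>f x\<bar>))"
      using sum_translate[of s "\<lambda>x. \<bar>f x\<bar>"] S_subset by auto
  qed
  finally show ?thesis
    by (simp add: sum_distrib_right[symmetric] mult.commute)
qed

text \<open>Splitting one step into two produces exactly the extra term
  \<open>h^2 * gen d (gen r f)\<close>; the constant 4 comes from bounding the two generators in
  turn.\<close>

lemma l1_dist_euler_add_rates:
  assumes r: "\<And>s. s \<in> S \<Longrightarrow> 0 \<le> r s" and d: "\<And>s. s \<in> S \<Longrightarrow> 0 \<le> d s"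
  shows "l1_dist (carrier G) (euler (\<lambda>s. r s + d s) h f) (euler d h (euler r h f))
    \<le> h\<^sup>2 * (4 * sum d S * sum r S * (\<Sum>x\<in>carrier G. \<bar>f x\<bar>))"
proof -
  have "euler d h (euler r h f) x = euler (\<lambda>s. r s + d s) h f x + h\<^sup>2 * gen d (gen r f) x" for x
    unfolding euler_def gen_linear gen_add_rates by (simp add: algebra_simps power2_eq_square)
  then have "l1_dist (carrier G) (euler (\<lambda>s. r s + d s) h f) (euler d h (euler r h f))
      = h\<^sup>2 * (\<Sum>x\<in>carrier G. \<bar>gen d (gen r f) x\<bar>)"
    by (simp add: l1_dist_def sum_distrib_left abs_mult)
  moreover have "(\<Sum>x\<in>carrier G. \<bar>gen d (gen r f) x\<bar>)
      \<le> 4 * sum d S * sum r S * (\<Sum>x\<in>carrier G. \<bar>f x\<bar>)"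
  proof -
    have "2 * sum d S * (\<Sum>x\<in>carrier G. \<bar>gen r f x\<bar>)
        \<le> 2 * sum d S * (2 * sum r S * (\<Sum>x\<in>carrier G. \<bar>f x\<bar>))"
      using d by (intro mult_left_mono sum_abs_gen r) (auto intro: sum_nonneg)
    moreover have "(\<Sum>x\<in>carrier G. \<bar>gen d (gen r f) x\<bar>)
        \<le> 2 * sum d S * (\<Sum>x\<in>carrier G. \<bar>gen r f x\<bar>)"
      by (rule sum_abs_gen) (rule d)
    ultimately show ?thesis by linarith
  qed
  ultimately show ?thesis
    by (simp only: mult_left_mono zero_le_power2)
qed

section \<open>Comparison of two rate functions\<close>

text \<open>The rates describe the chain only near time 0 and off the diagonal. Row sums supply the
  diagonal and the Chapman-Kolmogorov equation carries the estimate to every time \<open>s\<close>,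
  which gives an error \<open>e h = o(h)\<close> uniform in \<open>s\<close>.\<close>

lemma transition_function_euler_error:
  assumes p: "transition_function (carrier G) p"
    and rates: "has_jump_rates (carrier G) p (walk_rate G S r)"
    and a: "a \<in> carrier G"
  obtains e where "((\<lambda>h. e h / h) \<longlongrightarrow> 0) (at_right 0)"
    and "\<And>s h. 0 \<le> s \<Longrightarrow> 0 \<le> h \<Longrightarrow> l1_dist (carrier G) (p (s + h) a) (euler r h (p s a)) \<le> e h"
proof -
  \<comment> \<open>\<open>\<delta> z\<close> is the point mass at \<open>z\<close>, and
    \<open>E h z\<close> is the error of a single Euler step for the chain started at
    \<open>z\<close>. The factor 2 in \<open>e\<close> pays for the diagonal entry.\<close>
  define \<delta> :: "'a \<Rightarrow> 'a \<Rightarrow> real" where "\<delta> z x = of_bool (x = z)" for z x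
  define E where "E h z y = \<bar>p h z y - euler r h (\<delta> z) y\<bar>" for h z y
  define e where "e h = (\<Sum>z\<in>carrier G. 2 * (\<Sum>y\<in>carrier G - {z}. E h z y))" for h
  have euler_delta: "euler r h (\<delta> z) y = h * walk_rate G S r z y"
    if "z \<in> carrier G" "y \<in> carrier G" "y \<noteq> z" for h z y
  proof -
    have "gen r (\<delta> z) y = (\<Sum>s\<in>S. if z \<otimes> s = y then r s else 0)"
      unfolding gen_def using that S_subset
      by (auto simp: \<delta>_def subset_iff m_assoc intro!: sum.cong)
    then show ?thesis
      using that finite_S by (simp add: euler_def \<delta>_def walk_rate_def sum.inter_filter)
  qed
  \<comment> \<open>The exact row and the Euler row both have mass 1, so the diagonal error is minus
    the sum of the others.\<close>
  have row: "(\<Sum>y\<in>carrier G. E h z y) \<le> 2 * (\<Sum>y\<in>carrier G - {z}. E h z y)"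
    if h: "0 \<le> h" and z: "z \<in> carrier G" for h z
  proof -
    have "(\<Sum>y\<in>carrier G. p h z y - euler r h (\<delta> z) y) = 0"
      using p h z finite_carrier
      by (simp add: transition_function_def sum_subtractf sum_euler) (simp add: \<delta>_def)
    then have "p h z z - euler r h (\<delta> z) z
        = - (\<Sum>y\<in>carrier G - {z}. p h z y - euler r h (\<delta> z) y)"
      using sum.remove[OF finite_carrier z, of "\<lambda>y. p h z y - euler r h (\<delta> z) y"] by linarith
    then have "E h z z \<le> (\<Sum>y\<in>carrier G - {z}. E h z y)"
      by (simp add: E_def sum_abs)
    then show ?thesis
      using sum.remove[OF finite_carrier z, of "E h z"] by simp
  qed
  have "((\<lambda>h. E h z y / h) \<longlongrightarrow> 0) (at_right 0)"
    if "z \<in> carrier G" "y \<in> carrier G" "y \<noteq> z" for z y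
  proof -
    have "((\<lambda>h. p h z y / h) \<longlongrightarrow> walk_rate G S r z y) (at_right 0)"
      using rates that by (auto simp: has_jump_rates_def)
    then have "((\<lambda>h. \<bar>p h z y / h - walk_rate G S r z y\<bar>) \<longlongrightarrow> 0) (at_right 0)"
      by (simp add: tendsto_rabs_zero LIM_zero)
    moreover have "\<forall>\<^sub>F h in at_right 0. \<bar>p h z y / h - walk_rate G S r z y\<bar> = E h z y / h"
      using eventually_at_right_less[of "0::real"]
    proof eventually_elim
      case (elim h)
      then have "E h z y / h = \<bar>(p h z y - h * walk_rate G S r z y) / h\<bar>"
        using that by (simp add: E_def euler_delta abs_divide)
      then show ?case
        using elim by (simp add: diff_divide_distrib)
    qed
    ultimately show ?thesis
      by (rule Lim_transform_eventually)
  qed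
  then have "((\<lambda>h. \<Sum>z\<in>carrier G. 2 * (\<Sum>y\<in>carrier G - {z}. E h z y / h)) \<longlongrightarrow>
      (\<Sum>z\<in>carrier G. 2 * (\<Sum>y\<in>carrier G - {z}. 0))) (at_right 0)"
    by (intro tendsto_intros) auto
  then have "((\<lambda>h. e h / h) \<longlongrightarrow> 0) (at_right 0)"
    by (simp add: e_def sum_divide_distrib sum_distrib_left)
  moreover have "l1_dist (carrier G) (p (s + h) a) (euler r h (p s a)) \<le> e h"
    if s: "0 \<le> s" and h: "0 \<le> h" for s h
  proof -
    have nonneg: "0 \<le> p s a z" if "z \<in> carrier G" for z
      using p s a that by (simp add: transition_function_def)
    have mass: "(\<Sum>z\<in>carrier G. p s a z) = 1"
      using p s a by (simp add: transition_function_def)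
    have le_one: "p s a z \<le> 1" if "z \<in> carrier G" for z
      using member_le_sum[of z "carrier G" "p s a"] nonneg that finite_carrier mass by auto
    have decomp: "p s a y = (\<Sum>z\<in>carrier G. p s a z * \<delta> z y)" if "y \<in> carrier G" for y
      using that finite_carrier by (simp add: \<delta>_def of_bool_def if_distrib cong: if_cong)
    \<comment> \<open>The law at time \<open>s\<close> is a mixture of point masses, and the Euler
      step is linear.\<close>
    have euler_decomp: "euler r h (p s a) y = (\<Sum>z\<in>carrier G. p s a z * euler r h (\<delta> z) y)"
      if y: "y \<in> carrier G" for y
    proof -
      have "gen r (p s a) y = (\<Sum>t\<in>S. r t * (\<Sum>z\<in>carrier G. p s a z * (\<delta> z (y \<otimes> inv t) - \<delta> z y)))"
        unfolding gen_def using y S_subset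
        by (auto simp: decomp[symmetric] right_diff_distrib sum_subtractf subset_iff intro!: sum.cong)
      also have "\<dots> = (\<Sum>z\<in>carrier G. p s a z * gen r (\<delta> z) y)"
        using y by (simp add: gen_def sum_distrib_left sum.swap[of _ "carrier G" S] mult.left_commute)
      finally show ?thesis
        using decomp[OF y]
        by (simp add: euler_def distrib_left sum.distrib sum_distrib_left mult.left_commute)
    qed
    \<comment> \<open>Chapman-Kolmogorov writes \<open>p (s + h) a\<close> as the same mixture of
      the rows \<open>p h z\<close>, so the difference is a mixture of row errors.\<close>
    have "l1_dist (carrier G) (p (s + h) a) (euler r h (p s a))
        = (\<Sum>y\<in>carrier G. \<bar>\<Sum>z\<in>carrier G. p s a z * (p h z y - euler r h (\<delta> z) y)\<bar>)"
      using p s h a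
      by (auto simp: l1_dist_def transition_function_def euler_decomp right_diff_distrib
          sum_subtractf intro!: sum.cong)
    also have "\<dots> \<le> (\<Sum>y\<in>carrier G. \<Sum>z\<in>carrier G. E h z y)"
    proof (rule sum_mono)
      fix y
      have "\<bar>\<Sum>z\<in>carrier G. p s a z * (p h z y - euler r h (\<delta> z) y)\<bar>
          \<le> (\<Sum>z\<in>carrier G. \<bar>p s a z * (p h z y - euler r h (\<delta> z) y)\<bar>)"
        by (rule sum_abs)
      \<comment> \<open>Replacing the weights by 1 removes the dependence on
        \<open>s\<close>.\<close>
      also have "\<dots> \<le> (\<Sum>z\<in>carrier G. E h z y)"
        using nonneg le_one by (intro sum_mono) (auto simp: E_def abs_mult intro!: mult_left_le_one_le)
      finally show "\<bar>\<Sum>z\<in>carrier G. p s a z * (p h z y - euler r h (\<delta> z) y)\<bar>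
          \<le> (\<Sum>z\<in>carrier G. E h z y)" .
    qed
    also have "\<dots> = (\<Sum>z\<in>carrier G. \<Sum>y\<in>carrier G. E h z y)"
      by (rule sum.swap)
    also have "\<dots> \<le> e h"
      unfolding e_def using row[OF h] by (rule sum_mono)
    finally show ?thesis .
  qed
  ultimately show thesis
    using that by blast
qed

section \<open>Accumulated error and passage to the limit\<close>

text \<open>Here \<open>u\<close> and \<open>v\<close> stand for the laws with rates
  \<open>r\<close> and \<open>r + d\<close>. Each step adds the two Euler errors and one splitting
  error; earlier errors are not amplified because Euler steps contract in L1.\<close>

lemma l1_dist_funpow_euler_law:
  assumes r: "\<And>s. s \<in> S \<Longrightarrow> 0 \<le> r s" and d: "\<And>s. s \<in> S \<Longrightarrow> 0 \<le> d s"
    and h: "0 \<le> h" "h * (\<Sum>s\<in>S. r s + d s) \<le> 1"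
    and u: "\<And>s. 0 \<le> s \<Longrightarrow> l1_dist (carrier G) (u (s + h)) (euler r h (u s)) \<le> e"
    and v: "\<And>s. 0 \<le> s \<Longrightarrow> l1_dist (carrier G) (v (s + h)) (euler (\<lambda>s. r s + d s) h (v s)) \<le> e'"
    and mass: "\<And>s. 0 \<le> s \<Longrightarrow> (\<Sum>x\<in>carrier G. \<bar>u s x\<bar>) \<le> 1"
    and start: "\<And>x. x \<in> carrier G \<Longrightarrow> v 0 x = u 0 x"
  shows "l1_dist (carrier G) (v (real k * h)) ((euler d h ^^ k) (u (real k * h)))
    \<le> real k * (e' + e + h\<^sup>2 * (4 * sum d S * sum r S))"
proof (induction k)
  case 0
  then show ?case
    using start by (simp add: l1_dist_def)
next
  case (Suc k)
  let ?s = "real k * h" and ?r' = "\<lambda>s. r s + d s" and ?dist = "l1_dist (carrier G)"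
  let ?W = "euler ?r' h" and ?D = "euler d h ^^ k"
  have s: "0 \<le> ?s" "real (Suc k) * h = ?s + h"
    using h by (simp_all add: algebra_simps)
  have "h * sum d S \<le> h * sum ?r' S"
    using r h by (intro mult_left_mono sum_mono) auto
  then have hd: "h * sum d S \<le> 1"
    using h by linarith
  have r': "0 \<le> ?r' s" if "s \<in> S" for s
    using r d that by simp
  \<comment> \<open>The four distances are, in order: the Euler error of \<open>v\<close>, the
    induction hypothesis after a contraction, the splitting error, and the Euler error of
    \<open>u\<close>.\<close>
  have "?dist (v (?s + h)) ((euler d h ^^ Suc k) (u (?s + h)))
      \<le> ?dist (v (?s + h)) (?W (v ?s)) + ?dist (?W (v ?s)) (?W (?D (u ?s)))
        + ?dist (?W (?D (u ?s))) ((euler d h ^^ Suc k) (euler r h (u ?s)))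
        + ?dist ((euler d h ^^ Suc k) (euler r h (u ?s))) ((euler d h ^^ Suc k) (u (?s + h)))"
    by (meson l1_dist_triangle add_right_mono order_trans)
  moreover have "?dist (v (?s + h)) (?W (v ?s)) \<le> e'"
    using v s by simp
  moreover have "?dist (?W (v ?s)) (?W (?D (u ?s))) \<le> ?dist (v ?s) (?D (u ?s))"
    using l1_dist_euler[OF r' h] .
  moreover have "?dist (?W (?D (u ?s))) ((euler d h ^^ Suc k) (euler r h (u ?s)))
      \<le> h\<^sup>2 * (4 * sum d S * sum r S)"
  proof -
    \<comment> \<open>Commutation moves \<open>?W\<close> inside \<open>?D\<close>, and the
      contraction \<open>?D\<close> then leaves the splitting error of a single step.\<close>
    have "?dist (?W (?D (u ?s))) ((euler d h ^^ Suc k) (euler r h (u ?s)))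
        = ?dist (?D (?W (u ?s))) (?D (euler d h (euler r h (u ?s))))"
      by (simp only: funpow_euler_commute funpow_Suc_right o_apply)
    also have "\<dots> \<le> ?dist (?W (u ?s)) (euler d h (euler r h (u ?s)))"
      using l1_dist_funpow_euler[OF d h(1) hd] .
    also have "\<dots> \<le> h\<^sup>2 * (4 * sum d S * sum r S * (\<Sum>x\<in>carrier G. \<bar>u ?s x\<bar>))"
      using l1_dist_euler_add_rates[OF r d] .
    also have "\<dots> \<le> h\<^sup>2 * (4 * sum d S * sum r S * 1)"
      using mass[OF s(1)] r d by (intro mult_left_mono) (auto intro!: mult_nonneg_nonneg sum_nonneg)
    finally show ?thesis by simp
  qed
  moreover have "?dist ((euler d h ^^ Suc k) (euler r h (u ?s))) ((euler d h ^^ Suc k) (u (?s + h))) \<le> e"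
  proof -
    have "?dist ((euler d h ^^ Suc k) (euler r h (u ?s))) ((euler d h ^^ Suc k) (u (?s + h)))
        \<le> ?dist (euler r h (u ?s)) (u (?s + h))"
      using l1_dist_funpow_euler[OF d h(1) hd] .
    then show ?thesis
      using u[OF s(1)] by (simp only: l1_dist_commute[of _ "euler r h (u ?s)"])
  qed
  ultimately show ?case
    using Suc.IH unfolding s(2) by (simp add: algebra_simps)
qed

text \<open>With \<open>n\<close> steps, the law with rates \<open>r + d\<close> is close to
  \<open>n\<close> Euler steps of rates \<open>d\<close> applied to the law with rates
  \<open>r\<close>, and these steps do not increase a convex sum. The inequality thus holds up to an
  error that vanishes as \<open>n\<close> grows.\<close>

lemma truncated_sum_transition_mono:
  assumes r: "\<And>s. s \<in> S \<Longrightarrow> 0 \<le> r s" and d: "\<And>s. s \<in> S \<Longrightarrow> 0 \<le> d s"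
    and p: "transition_function (carrier G) p" "has_jump_rates (carrier G) p (walk_rate G S r)"
    and p': "transition_function (carrier G) p'"
      "has_jump_rates (carrier G) p' (walk_rate G S (\<lambda>s. r s + d s))"
    and a: "a \<in> carrier G" and t: "0 < t"
  shows "(\<Sum>x\<in>carrier G. max 0 (p' t a x - c)) \<le> (\<Sum>x\<in>carrier G. max 0 (p t a x - c))"
proof -
  let ?R = "\<Sum>s\<in>S. r s + d s"
  obtain e where e: "((\<lambda>h. e h / h) \<longlongrightarrow> 0) (at_right 0)"
    "\<And>s h. 0 \<le> s \<Longrightarrow> 0 \<le> h \<Longrightarrow> l1_dist (carrier G) (p (s + h) a) (euler r h (p s a)) \<le> e h"
    using transition_function_euler_error[OF p a] by blast
  obtain e' where e': "((\<lambda>h. e' h / h) \<longlongrightarrow> 0) (at_right 0)"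
    "\<And>s h. 0 \<le> s \<Longrightarrow> 0 \<le> h \<Longrightarrow>
      l1_dist (carrier G) (p' (s + h) a) (euler (\<lambda>s. r s + d s) h (p' s a)) \<le> e' h"
    using transition_function_euler_error[OF p' a] by blast
  \<comment> \<open>This is the accumulated error of \<open>t / h\<close> steps; only
    \<open>e h / h\<close> and \<open>e' h / h\<close> enter, so \<open>o(h)\<close> errors
    suffice.\<close>
  define B where "B h = t * (e' h / h + e h / h + h * (4 * sum d S * sum r S))" for h
  have bound: "(\<Sum>x\<in>carrier G. max 0 (p' t a x - c))
      \<le> (\<Sum>x\<in>carrier G. max 0 (p t a x - c)) + B (t / real n)"
    if n: "n > 0" and small: "t / real n * ?R \<le> 1" for n
  proof -
    define h where "h = t / real n"
    have h: "0 < h" "real n * h = t"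
      using n t by (simp_all add: h_def)
    define q where "q = (euler d h ^^ n) (p t a)"
    have hR: "h * ?R \<le> 1"
      using small by (simp add: h_def)
    have "h * sum d S \<le> h * ?R"
      using r h by (intro mult_left_mono sum_mono) auto
    then have hd: "h * sum d S \<le> 1"
      using hR by linarith
    have mass: "(\<Sum>x\<in>carrier G. \<bar>p s a x\<bar>) \<le> 1" if "0 \<le> s" for s
      using p(1) that a by (simp add: transition_function_def)
    have start: "p' 0 a x = p 0 a x" if "x \<in> carrier G" for x
      using p(1) p'(1) that a by (simp add: transition_function_def)
    have "l1_dist (carrier G) (p' (real n * h) a) ((euler d h ^^ n) (p (real n * h) a))
        \<le> real n * (e' h + e h + h\<^sup>2 * (4 * sum d S * sum r S))"
      by (rule l1_dist_funpow_euler_law[where u = "\<lambda>s. p s a" and v = "\<lambda>s. p' s a",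
            OF r d less_imp_le[OF h(1)] hR e(2) e'(2) mass start])
        (use h in auto)
    also have "\<dots> = B h"
      using h by (simp add: B_def h(2)[symmetric] field_simps power2_eq_square)
    finally have dist: "l1_dist (carrier G) (p' t a) q \<le> B h"
      by (simp add: h q_def)
    \<comment> \<open>Truncation is 1-Lipschitz, so replacing \<open>p' t a\<close> by
      \<open>q\<close> costs at most their L1 distance.\<close>
    have "(\<Sum>x\<in>carrier G. max 0 (p' t a x - c))
        \<le> (\<Sum>x\<in>carrier G. max 0 (q x - c) + \<bar>p' t a x - q x\<bar>)"
      by (intro sum_mono) linarith
    also have "\<dots> = (\<Sum>x\<in>carrier G. max 0 (q x - c)) + l1_dist (carrier G) (p' t a) q"
      by (simp add: sum.distrib l1_dist_def)
    also have "(\<Sum>x\<in>carrier G. max 0 (q x - c)) \<le> (\<Sum>x\<in>carrier G. max 0 (p t a x - c))"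
      unfolding q_def
    proof (rule convex_sum_funpow_euler[where \<phi> = "\<lambda>v. max 0 (v - c)", OF _ d _ hd])
      show "convex_on UNIV (\<lambda>v. max 0 (v - c))"
      proof (intro convex_onI)
        fix l x y :: real assume "0 < l" "l < 1"
        then have "(1 - l) * (x - c) \<le> (1 - l) * max 0 (x - c)" "l * (y - c) \<le> l * max 0 (y - c)"
          "0 \<le> (1 - l) * max 0 (x - c)" "0 \<le> l * max 0 (y - c)"
          by (simp_all add: mult_left_mono)
        then show "max 0 ((1 - l) *\<^sub>R x + l *\<^sub>R y - c) \<le> (1 - l) * max 0 (x - c) + l * max 0 (y - c)"
          by (simp add: max_def right_diff_distrib left_diff_distrib)
      qed simp
    qed (use h in auto)
    finally show ?thesis
      using dist by (simp add: h_def)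
  qed
  have "(B \<longlongrightarrow> t * (0 + 0 + 0 * (4 * sum d S * sum r S))) (at_right 0)"
    unfolding B_def by (intro tendsto_intros e(1) e'(1))
  moreover have step: "filterlim (\<lambda>n. t / real n) (at_right 0) sequentially"
    using t by real_asymp
  ultimately have "(\<lambda>n. B (t / real n)) \<longlonglongrightarrow> 0"
    by (auto intro: filterlim_compose)
  then have lim: "(\<lambda>n. (\<Sum>x\<in>carrier G. max 0 (p t a x - c)) + B (t / real n))
      \<longlonglongrightarrow> (\<Sum>x\<in>carrier G. max 0 (p t a x - c))"
    using tendsto_add[OF tendsto_const] by fastforce
  \<comment> \<open>The step-size condition of \<open>bound\<close> holds for all large
    \<open>n\<close>.\<close>
  have "(\<lambda>n. t / real n * ?R) \<longlonglongrightarrow> 0 * ?R"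
    by (intro tendsto_mult_right lim_const_over_n)
  then have "\<forall>\<^sub>F n in sequentially. t / real n * ?R < 1"
    by (rule order_tendstoD) simp
  then have "\<forall>\<^sub>F n in sequentially. (\<Sum>x\<in>carrier G. max 0 (p' t a x - c))
      \<le> (\<Sum>x\<in>carrier G. max 0 (p t a x - c)) + B (t / real n)"
    using eventually_gt_at_top[of "0::nat"] by eventually_elim (rule bound, auto)
  then show ?thesis
    by (intro tendsto_lowerbound[OF lim]) auto
qed

end

section \<open>From the process to its transition function\<close>

text \<open>The Markov property relates strictly increasing times, so the law at
  \<open>t > 0\<close> is read off from the joint law at times 0 and \<open>t\<close>, the start
  being almost surely the identity.\<close>

lemma random_walk_law_eq_transition:
  assumes "comm_group G" and "random_walk_from_one M G S r X"
  obtains p where "transition_function (carrier G) p"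
    and "has_jump_rates (carrier G) p (walk_rate G S r)"
    and "\<And>t x. 0 < t \<Longrightarrow> x \<in> carrier G \<Longrightarrow> law_at M X t x = p t \<one>\<^bsub>G\<^esub> x"
proof -
  interpret comm_group G by fact
  have chain: "continuous_time_markov_chain M (carrier G) (walk_rate G S r) X"
    and start: "\<P>(\<omega> in M. X 0 \<omega> = \<one>\<^bsub>G\<^esub>) = 1"
    using assms(2) by (auto simp: random_walk_from_one_def)
  interpret prob_space M
    using chain by (simp add: continuous_time_markov_chain_def)
  have meas: "X t \<in> measurable M (count_space (carrier G))" if "0 \<le> t" for t
    using chain that by (simp add: continuous_time_markov_chain_def)
  obtain p where p: "transition_function (carrier G) p"
      "has_jump_rates (carrier G) p (walk_rate G S r)"
    and markov: "\<And>n (\<tau> :: nat \<Rightarrow> real) (x :: nat \<Rightarrow> _).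
      0 \<le> \<tau> 0 \<Longrightarrow> (\<forall>i\<le>n. \<tau> i < \<tau> (Suc i)) \<Longrightarrow> (\<forall>i\<le>Suc n. x i \<in> carrier G) \<Longrightarrow>
        \<P>(\<omega> in M. \<forall>i\<le>Suc n. X (\<tau> i) \<omega> = x i) =
        \<P>(\<omega> in M. \<forall>i\<le>n. X (\<tau> i) \<omega> = x i) * p (\<tau> (Suc n) - \<tau> n) (x n) (x (Suc n))"
    using chain unfolding continuous_time_markov_chain_def by blast
  have "law_at M X t x = p t \<one>\<^bsub>G\<^esub> x" if t: "0 < t" and x: "x \<in> carrier G" for t x
  proof -
    have ev: "{\<omega> \<in> space M. X s \<omega> = y} \<in> events" if "0 \<le> s" "y \<in> carrier G" for s y
    proof -
      have "X s -` {y} \<inter> space M \<in> events"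
        using meas[OF that(1)] that(2) by (auto intro: measurable_sets)
      also have "X s -` {y} \<inter> space M = {\<omega> \<in> space M. X s \<omega> = y}" by auto
      finally show ?thesis .
    qed
    have le1: "(\<forall>i\<le>Suc 0. P i) \<longleftrightarrow> P 0 \<and> P (Suc 0)" for P
      by (auto simp: le_Suc_eq)
    \<comment> \<open>The Markov property at \<open>n = 0\<close>; its first factor is the starting
      probability 1.\<close>
    have "\<P>(\<omega> in M. X 0 \<omega> = \<one>\<^bsub>G\<^esub> \<and> X t \<omega> = x) = p t \<one>\<^bsub>G\<^esub> x"
      using markov[of "\<lambda>i. if i = 0 then 0 else t" 0 "\<lambda>i. if i = 0 then \<one>\<^bsub>G\<^esub> else x"] t x start
      unfolding le1 by simp
    moreover have "AE \<omega> in M. X 0 \<omega> = \<one>\<^bsub>G\<^esub>"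
      using start ev[of 0 "\<one>\<^bsub>G\<^esub>"] by (simp add: prob_Collect_eq_1)
    then have "\<P>(\<omega> in M. X t \<omega> = x) = \<P>(\<omega> in M. X 0 \<omega> = \<one>\<^bsub>G\<^esub> \<and> X t \<omega> = x)"
    proof (intro finite_measure_eq_AE)
      have "{\<omega> \<in> space M. X 0 \<omega> = \<one>\<^bsub>G\<^esub> \<and> X t \<omega> = x}
          = {\<omega> \<in> space M. X 0 \<omega> = \<one>\<^bsub>G\<^esub>} \<inter> {\<omega> \<in> space M. X t \<omega> = x}" by auto
      then show "{\<omega> \<in> space M. X 0 \<omega> = \<one>\<^bsub>G\<^esub> \<and> X t \<omega> = x} \<in> events"
        using ev t x by auto
    qed (use ev t x in auto)
    ultimately show ?thesis
      by (simp add: law_at_def)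
  qed
  with p show thesis
    using that by blast
qed

theorem mainTheorem4:
  fixes G :: "('a, 'b) monoid_scheme"
    and S :: "'a set"
    and r r' :: "'a \<Rightarrow> real"
    and M :: "'w measure" and M' :: "'v measure"
    and X :: "real \<Rightarrow> 'w \<Rightarrow> 'a" and X' :: "real \<Rightarrow> 'v \<Rightarrow> 'a"
    and t :: real
  assumes "comm_group G" and "finite (carrier G)"
    and "S \<subseteq> carrier G" and "generate G S = carrier G"
    and "\<And>s. s \<in> S \<Longrightarrow> inv\<^bsub>G\<^esub> s \<in> S"
    and "\<And>s. s \<in> S \<Longrightarrow> r s > 0" and "\<And>s. s \<in> S \<Longrightarrow> r' s > 0"
    and "\<And>s. s \<in> S \<Longrightarrow> r s = r (inv\<^bsub>G\<^esub> s)" and "\<And>s. s \<in> S \<Longrightarrow> r' s = r' (inv\<^bsub>G\<^esub> s)"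
    and "\<And>s. s \<in> S \<Longrightarrow> r s \<le> r' s"
    and "t > 0"
    and "random_walk_from_one M G S r X"
    and "random_walk_from_one M' G S r' X'"
  shows "majorizes_on (carrier G) (law_at M X t) (law_at M' X' t)"
proof -
  interpret comm_group G by fact
  interpret finite_abelian_walk G S
    using assms(2,3) by unfold_locales
  obtain p where p: "transition_function (carrier G) p"
      "has_jump_rates (carrier G) p (walk_rate G S r)"
    and law: "\<And>x. x \<in> carrier G \<Longrightarrow> law_at M X t x = p t \<one>\<^bsub>G\<^esub> x"
    using random_walk_law_eq_transition[OF assms(1,12)] \<open>t > 0\<close> by metis
  obtain p' where p': "transition_function (carrier G) p'"
      "has_jump_rates (carrier G) p' (walk_rate G S r')"
    and law': "\<And>x. x \<in> carrier G \<Longrightarrow> law_at M' X' t x = p' t \<one>\<^bsub>G\<^esub> x"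
    using random_walk_law_eq_transition[OF assms(1,13)] \<open>t > 0\<close> by metis
  \<comment> \<open>The extra rates \<open>r' - r\<close> are nonnegative by hypothesis and add up
    with \<open>r\<close> to \<open>r'\<close>.\<close>
  have "(\<Sum>x\<in>carrier G. max 0 (p' t \<one>\<^bsub>G\<^esub> x - c)) \<le> (\<Sum>x\<in>carrier G. max 0 (p t \<one>\<^bsub>G\<^esub> x - c))" for c
    by (rule truncated_sum_transition_mono[where r = r and d = "\<lambda>s. r' s - r s"])
      (use p p' assms(6,10,11) in \<open>auto intro: less_imp_le\<close>)
  then show ?thesis
    using p(1) p'(1) \<open>t > 0\<close>
    by (intro majorizes_onI_truncated_sums) (simp_all add: law law' transition_function_def)
qed

end
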